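(* Let $\mathcal{M}=(E,\mathcal{T})$ be a simple oriented matroid that is not acyclic, on ground set $E$, with set of topes $\mathcal{T}$. Let $\boldsymbol{\Gamma}$ be the simple graph with vertex set $\mathcal{T}$ in which a pair $\{T',T''\}\subset\mathcal{T}$ is an edge if and only if $(T')^+\cup(T'')^+=E$. Then the three-tope committees for $\mathcal{M}$ are precisely the vertex sets of the triangles in $\boldsymbol{\Gamma}$; that is, a $3$-subset $\{T',T'',T'''\}\subset\mathcal{T}$ is a tope committee for $\mathcal{M}$ if and only if its three elements are pairwise adjacent in $\boldsymbol{\Gamma}$.
   Context: An oriented matroid is called simple here if it has no loops, no parallel elements and no antiparallel elements. Topes are the maximal covectors, regarded as sign vectors $T\in\{+,-\}^E$ (there are no loops). $\mathcal{M}$ is acyclic if it has the tope all of whose components are $+$. For a sign vector $F$, $F^+$ and $F^-$ denote its positive and negative parts, i.e. the sets of $e\in E$ with $F(e)=+$ and $F(e)=-$, respectively. For $e\in E$, the positive halfspace corresponding to $e$ is $\mathcal{T}_e^+:=\{T\in\mathcal{T}: T(e)=+\}$. A tope committee for $\mathcal{M}$ is a subset $\mathcal{K}^{\ast}\subset\mathcal{T}$ such that $|\mathcal{T}_e^+\cap\mathcal{K}^{\ast}|>\frac12|\mathcal{K}^{\ast}|$ for every $e\in E$; a three-tope committee is a tope committee with $|\mathcal{K}^{\ast}|=3$. *)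

theory Defs
  imports Complex_Main
begin

datatype sign = Neg | Zero | Pos

instantiation sign :: uminus
begin

fun uminus_sign :: "sign \<Rightarrow> sign" where
  "- Neg = Pos"
| "- Zero = Zero"
| "- Pos = Neg"

instance ..

end

text \<open>A sign vector on the ground set \<open>E\<close> is a function that vanishes outside \<open>E\<close>, so that
  sign vectors on \<open>E\<close> are equal iff they agree on \<open>E\<close>.\<close>

type_synonym 'a signvec = "'a \<Rightarrow> sign"

definition signvecs :: "'a set \<Rightarrow> 'a signvec set" where
  "signvecs E = {X. \<forall>e. e \<notin> E \<longrightarrow> X e = Zero}"

definition pos_part :: "'a signvec \<Rightarrow> 'a set" where
  "pos_part X = {e. X e = Pos}"

definition sv_comp :: "'a signvec \<Rightarrow> 'a signvec \<Rightarrow> 'a signvec" where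
  "sv_comp X Y = (\<lambda>e. if X e \<noteq> Zero then X e else Y e)"

definition separation :: "'a signvec \<Rightarrow> 'a signvec \<Rightarrow> 'a set" where
  "separation X Y = {e. X e \<noteq> Zero \<and> X e = - Y e}"

definition sv_le :: "'a signvec \<Rightarrow> 'a signvec \<Rightarrow> bool" where
  "sv_le X Y \<longleftrightarrow> (\<forall>e. X e = Zero \<or> X e = Y e)"

text \<open>Covector axioms (L0)--(L3) of Bjoerner, Las Vergnas, Sturmfels, White and Ziegler.\<close>

locale oriented_matroid =
  fixes E :: "'a set" and L :: "'a signvec set"
  assumes finite_ground: "finite E"
    and covectors_on_ground: "L \<subseteq> signvecs E"
    and zero_covector: "(\<lambda>_. Zero) \<in> L"
    and symmetry: "X \<in> L \<Longrightarrow> (\<lambda>e. - X e) \<in> L"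
    and composition: "X \<in> L \<Longrightarrow> Y \<in> L \<Longrightarrow> sv_comp X Y \<in> L"
    and elimination: "X \<in> L \<Longrightarrow> Y \<in> L \<Longrightarrow> e \<in> separation X Y \<Longrightarrow>
      \<exists>Z\<in>L. Z e = Zero \<and> (\<forall>f\<in>E - separation X Y. Z f = sv_comp X Y f)"

definition is_loop :: "'a signvec set \<Rightarrow> 'a \<Rightarrow> bool" where
  "is_loop L e \<longleftrightarrow> (\<forall>X\<in>L. X e = Zero)"

definition parallel :: "'a signvec set \<Rightarrow> 'a \<Rightarrow> 'a \<Rightarrow> bool" where
  "parallel L e f \<longleftrightarrow> e \<noteq> f \<and> (\<forall>X\<in>L. X e = X f)"

definition antiparallel :: "'a signvec set \<Rightarrow> 'a \<Rightarrow> 'a \<Rightarrow> bool" where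
  "antiparallel L e f \<longleftrightarrow> e \<noteq> f \<and> (\<forall>X\<in>L. X e = - X f)"

definition simple_om :: "'a set \<Rightarrow> 'a signvec set \<Rightarrow> bool" where
  "simple_om E L \<longleftrightarrow> oriented_matroid E L \<and> (\<forall>e\<in>E. \<not> is_loop L e) \<and>
    (\<forall>e\<in>E. \<forall>f\<in>E. \<not> parallel L e f \<and> \<not> antiparallel L e f)"

definition topes :: "'a signvec set \<Rightarrow> 'a signvec set" where
  "topes L = {T \<in> L. \<forall>X\<in>L. sv_le T X \<longrightarrow> X = T}"

definition acyclic_om :: "'a set \<Rightarrow> 'a signvec set \<Rightarrow> bool" where
  "acyclic_om E L \<longleftrightarrow> (\<exists>T\<in>topes L. \<forall>e\<in>E. T e = Pos)"

lemma tope_nonzero: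
  assumes "simple_om E L" "T \<in> topes L" "e \<in> E"
  shows "T e \<noteq> Zero"
proof
  assume z: "T e = Zero"
  obtain X where X: "X \<in> L" "X e \<noteq> Zero"
    using assms unfolding simple_om_def is_loop_def by blast
  have "sv_comp T X \<in> L"
    using assms X oriented_matroid.composition unfolding simple_om_def topes_def by blast
  moreover have "sv_le T (sv_comp T X)"
    by (simp add: sv_le_def sv_comp_def)
  ultimately have "sv_comp T X = T"
    using assms by (simp add: topes_def)
  then have "sv_comp T X e = T e" by simp
  with z X show False by (simp add: sv_comp_def)
qed

definition pos_halfspace :: "'a signvec set \<Rightarrow> 'a \<Rightarrow> 'a signvec set" where
  "pos_halfspace L e = {T \<in> topes L. T e = Pos}"

definition tope_committee :: "'a set \<Rightarrow> 'a signvec set \<Rightarrow> 'a signvec set \<Rightarrow> bool" where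
  "tope_committee E L K \<longleftrightarrow> K \<subseteq> topes L \<and>
    (\<forall>e\<in>E. real (card (pos_halfspace L e \<inter> K)) > 1 / 2 * real (card K))"

definition three_tope_committee :: "'a set \<Rightarrow> 'a signvec set \<Rightarrow> 'a signvec set \<Rightarrow> bool" where
  "three_tope_committee E L K \<longleftrightarrow> tope_committee E L K \<and> card K = 3"

text \<open>A graph is a pair of a vertex set and a set of edges, an edge being a two-element set of
  vertices.\<close>

type_synonym 'v graph = "'v set \<times> 'v set set"

definition simple_graph :: "'v graph \<Rightarrow> bool" where
  "simple_graph G \<longleftrightarrow> (\<forall>a\<in>snd G. a \<subseteq> fst G \<and> card a = 2)"

definition adjacent :: "'v graph \<Rightarrow> 'v \<Rightarrow> 'v \<Rightarrow> bool" where
  "adjacent G u v \<longleftrightarrow> {u, v} \<in> snd G"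

definition triangle_vertex_sets :: "'v graph \<Rightarrow> 'v set set" where
  "triangle_vertex_sets G = {{u, v, w} | u v w. u \<in> fst G \<and> v \<in> fst G \<and> w \<in> fst G \<and>
    u \<noteq> v \<and> v \<noteq> w \<and> u \<noteq> w \<and> adjacent G u v \<and> adjacent G v w \<and> adjacent G u w}"

definition Gamma_graph :: "'a set \<Rightarrow> 'a signvec set \<Rightarrow> 'a signvec graph" where
  "Gamma_graph E L = (topes L,
    {{T', T''} | T' T''. T' \<in> topes L \<and> T'' \<in> topes L \<and> T' \<noteq> T'' \<and>
       pos_part T' \<union> pos_part T'' = E})"

lemma simple_graph_Gamma: "simple_graph (Gamma_graph E L)"
  by (auto simp: simple_graph_def Gamma_graph_def)

end

theory Submission
  imports Defs
begin

text \<open>More than half of three means two. For each element of \<open>E\<close>, at least two of three topes are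
  positive on it iff at least one tope of every pair is, so the committee condition is that each
  pair of positive parts covers \<open>E\<close>.\<close>

lemma pos_part_tope_subset:
  assumes "oriented_matroid E L" "T \<in> topes L"
  shows "pos_part T \<subseteq> E"
  using oriented_matroid.covectors_on_ground[OF assms(1)] assms(2)
  by (force simp: topes_def signvecs_def pos_part_def)

text \<open>Positive parts of topes lie in \<open>E\<close>, so in the edge condition only the
  inclusion of \<open>E\<close> in the union has content. That inclusion can be read element by
  element, like the committee condition.\<close>

lemma adjacent_Gamma_iff:
  assumes "oriented_matroid E L" "u \<in> topes L" "v \<in> topes L" "u \<noteq> v"
  shows "adjacent (Gamma_graph E L) u v \<longleftrightarrow> (\<forall>e\<in>E. u e = Pos \<or> v e = Pos)"
proof -
  \<comment> \<open>An edge is an unordered pair, so its defining witnesses may be \<open>u\<close>,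
    \<open>v\<close> in either order; the union does not depend on the order.\<close>
  have "adjacent (Gamma_graph E L) u v \<longleftrightarrow> pos_part u \<union> pos_part v = E"
    using assms(2-4) by (auto simp: adjacent_def Gamma_graph_def doubleton_eq_iff)
  also have "\<dots> \<longleftrightarrow> E \<subseteq> pos_part u \<union> pos_part v"
    using pos_part_tope_subset[OF assms(1)] assms(2,3) by blast
  finally show ?thesis
    by (auto simp: pos_part_def)
qed

lemma tope_committee_triple_iff:
  assumes "u \<in> topes L" "v \<in> topes L" "w \<in> topes L" "u \<noteq> v" "v \<noteq> w" "u \<noteq> w"
  shows "tope_committee E L {u, v, w} \<longleftrightarrow>
    (\<forall>e\<in>E. (u e = Pos \<or> v e = Pos) \<and> (v e = Pos \<or> w e = Pos) \<and> (u e = Pos \<or> w e = Pos))"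
proof -
  have "real (card (pos_halfspace L e \<inter> {u, v, w})) > 1 / 2 * real (card {u, v, w}) \<longleftrightarrow>
      (u e = Pos \<or> v e = Pos) \<and> (v e = Pos \<or> w e = Pos) \<and> (u e = Pos \<or> w e = Pos)" for e
    \<comment> \<open>Inserting the topes one at a time splits on the three signs at
      \<open>e\<close>. As the topes are distinct, the cardinality counts the \<open>Pos\<close>
      signs, and a count above 3/2 is at least 2.\<close>
    using assms by (simp add: pos_halfspace_def Int_insert_right)
  then show ?thesis
    using assms(1-3) by (simp add: tope_committee_def)
qed

lemma tope_committee_triple_iff_adjacent:
  assumes "oriented_matroid E L" "u \<in> topes L" "v \<in> topes L" "w \<in> topes L"
    and "u \<noteq> v" "v \<noteq> w" "u \<noteq> w"
  shows "tope_committee E L {u, v, w} \<longleftrightarrow>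
    adjacent (Gamma_graph E L) u v \<and> adjacent (Gamma_graph E L) v w \<and>
    adjacent (Gamma_graph E L) u w"
  using assms by (auto simp: tope_committee_triple_iff adjacent_Gamma_iff)

theorem mainTheorem1:
  fixes E :: "'a set" and L :: "'a signvec set"
  assumes "simple_om E L"
    and "\<not> acyclic_om E L"
  shows "{K. three_tope_committee E L K} = triangle_vertex_sets (Gamma_graph E L) \<and>
    (\<forall>T' \<in> topes L. \<forall>T'' \<in> topes L. \<forall>T''' \<in> topes L. card {T', T'', T'''} = 3 \<longrightarrow>
      (tope_committee E L {T', T'', T'''} \<longleftrightarrow>
        adjacent (Gamma_graph E L) T' T'' \<and>
        adjacent (Gamma_graph E L) T'' T''' \<and>
        adjacent (Gamma_graph E L) T' T'''))"
proof -
  have om: "oriented_matroid E L"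
    using assms(1) by (simp add: simple_om_def)
  have vertices: "fst (Gamma_graph E L) = topes L"
    by (simp add: Gamma_graph_def)
  have "three_tope_committee E L K \<longleftrightarrow> K \<in> triangle_vertex_sets (Gamma_graph E L)" for K
  proof
    assume K: "three_tope_committee E L K"
    then obtain u v w where uvw: "K = {u, v, w}" "u \<noteq> v" "v \<noteq> w" "u \<noteq> w"
      unfolding three_tope_committee_def card_3_iff by metis
    \<comment> \<open>A committee consists of topes by definition, which makes its members vertices
      of the graph.\<close>
    moreover have "u \<in> topes L" "v \<in> topes L" "w \<in> topes L"
      using K uvw(1) by (auto simp: three_tope_committee_def tope_committee_def)
    ultimately show "K \<in> triangle_vertex_sets (Gamma_graph E L)"
      using K tope_committee_triple_iff_adjacent[OF om]
      unfolding triangle_vertex_sets_def vertices three_tope_committee_def by blast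
  next
    assume "K \<in> triangle_vertex_sets (Gamma_graph E L)"
    then show "three_tope_committee E L K"
      using tope_committee_triple_iff_adjacent[OF om]
      by (auto simp: triangle_vertex_sets_def vertices three_tope_committee_def)
  qed
  \<comment> \<open>The second conjunct expresses a 3-subset by its cardinality; this recovers the
    distinctness that the equivalence for triples assumes.\<close>
  moreover have "u \<noteq> v \<and> v \<noteq> w \<and> u \<noteq> w" if "card {u, v, w} = 3" for u v w :: "'a signvec"
    using that by (auto simp: card_insert_if split: if_splits)
  ultimately show ?thesis
    using tope_committee_triple_iff_adjacent[OF om] by blast
qed

end
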